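(* The class of transitive Kripke frames of locally finite height is a proper subclass of the class of transitive Kripke frames in which the rule $(\Diamond^{*})$ is weakly valid.
   Context: Modal formulas are built from a countable set $\mathsf{Prop}$ of propositional variables and $\top,\bot$ using $\land$, $\neg$ and $\Box$; $\lor$ and $\supset$ are defined in the usual way, $\Diamond\phi$ abbreviates $\neg\Box\neg\phi$, and $\Diamond^{n}$ is the $n$-fold application of $\Diamond$. A Kripke frame is a pair $F=\langle W,R\rangle$ with $W$ a non-empty set and $R$ a binary relation on $W$; it is transitive if $R$ is transitive. A valuation on $F$ is a map $v:\mathsf{Prop}\to\mathcal{P}(W)$, extended to all formulas by $v(\top)=W$, $v(\bot)=\emptyset$, $v(\phi\land\psi)=v(\phi)\cap v(\psi)$, $v(\neg\phi)=W\setminus v(\phi)$, $v(\Box\phi)=\{w\in W\mid \forall w'\in W\,((w,w')\in R\Rightarrow w'\in v(\phi))\}$. A formula $\phi$ is valid in $F$ ($F\models\phi$) if $v(\phi)=W$ for every valuation $v$ on $F$; a set $\Gamma$ of formulas is valid in $F$ ($F\models\Gamma$) if every $\gamma\in\Gamma$ is valid in $F$. For $w\in W$, the height from $w$ is finite if the supremum of the lengths of lists $w=w_0,w_1,\ldots,w_n\in W$ with $(w_i,w_{i+1})\in R$ for all $i<n$ is finite. $F$ is of locally finite height if for every $w\in W$ the height from $w$ is finite. An inference rule is a pair $(\Gamma,\phi)$ of a (possibly infinite) set $\Gamma$ of formulas and a formula $\phi$. It is weakly valid in $F$ if $F\models\Gamma$ implies $F\models\phi$. The rule $(\Diamond^{*})$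 is the scheme consisting of all pairs $(\{\phi\supset\Diamond^{n}\top\mid n\in\omega\},\ \phi\supset\bot)$, where $\phi$ ranges over all formulas; it is weakly valid in $F$ if all these pairs are weakly valid in $F$. *)

theory Defs
  imports Main "HOL-Library.Countable" "HOL-Library.Extended_Nat"
begin

datatype 'p fm =
    Var 'p
  | Top
  | Bot
  | And "'p fm" "'p fm"
  | Neg "'p fm"
  | Box "'p fm"

definition Imp :: "'p fm \<Rightarrow> 'p fm \<Rightarrow> 'p fm" where
  "Imp \<phi> \<psi> = Neg (And \<phi> (Neg \<psi>))"

definition Dia :: "'p fm \<Rightarrow> 'p fm" where
  "Dia \<phi> = Neg (Box (Neg \<phi>))"

datatype 'w frame = Frame (worlds: "'w set") (acc: "('w \<times> 'w) set")

definition kripke_frame :: "'w frame \<Rightarrow> bool" where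
  "kripke_frame F \<longleftrightarrow> worlds F \<noteq> {} \<and> acc F \<subseteq> worlds F \<times> worlds F"

definition transitive_frame :: "'w frame \<Rightarrow> bool" where
  "transitive_frame F \<longleftrightarrow> kripke_frame F \<and> trans (acc F)"

definition valuation :: "'w frame \<Rightarrow> ('p \<Rightarrow> 'w set) \<Rightarrow> bool" where
  "valuation F v \<longleftrightarrow> (\<forall>p. v p \<subseteq> worlds F)"

primrec extend :: "'w frame \<Rightarrow> ('p \<Rightarrow> 'w set) \<Rightarrow> 'p fm \<Rightarrow> 'w set" where
  "extend F v (Var p) = v p"
| "extend F v Top = worlds F"
| "extend F v Bot = {}"
| "extend F v (And \<phi> \<psi>) = extend F v \<phi> \<inter> extend F v \<psi>"
| "extend F v (Neg \<phi>) = worlds F - extend F v \<phi>"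
| "extend F v (Box \<phi>) =
     {w \<in> worlds F. \<forall>w' \<in> worlds F. (w, w') \<in> acc F \<longrightarrow> w' \<in> extend F v \<phi>}"

definition valid :: "'w frame \<Rightarrow> 'p fm \<Rightarrow> bool" where
  "valid F \<phi> \<longleftrightarrow> (\<forall>v. valuation F v \<longrightarrow> extend F v \<phi> = worlds F)"

definition valid_set :: "'w frame \<Rightarrow> 'p fm set \<Rightarrow> bool" where
  "valid_set F \<Gamma> \<longleftrightarrow> (\<forall>\<gamma> \<in> \<Gamma>. valid F \<gamma>)"

text \<open>The supremum is taken in the extended naturals, so an unbounded set of lengths gives
  \<open>\<infinity>\<close>.\<close>

definition height :: "'w frame \<Rightarrow> 'w \<Rightarrow> enat" where
  "height F w =
     (SUP xs \<in> {xs. xs \<noteq> [] \<and> hd xs = w \<and> set xs \<subseteq> worlds F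
                    \<and> successively (\<lambda>x y. (x, y) \<in> acc F) xs}. enat (length xs))"

definition locally_finite_height :: "'w frame \<Rightarrow> bool" where
  "locally_finite_height F \<longleftrightarrow> (\<forall>w \<in> worlds F. height F w < \<infinity>)"

type_synonym 'p rule = "'p fm set \<times> 'p fm"

definition weakly_valid :: "'w frame \<Rightarrow> 'p rule \<Rightarrow> bool" where
  "weakly_valid F r \<longleftrightarrow> (valid_set F (fst r) \<longrightarrow> valid F (snd r))"

definition scheme_weakly_valid :: "'w frame \<Rightarrow> 'p rule set \<Rightarrow> bool" where
  "scheme_weakly_valid F S \<longleftrightarrow> (\<forall>r \<in> S. weakly_valid F r)"

definition diamond_star :: "'p rule set" where
  "diamond_star = {(range (\<lambda>n. Imp \<phi> ((Dia ^^ n) Top)), Imp \<phi> Bot) |\<phi>. True}"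

text \<open>The two classes below are polymorphic in the type \<open>'w\<close> from which worlds are drawn; a
  class of all frames is the collection of its instances at every type.  An inclusion between
  classes is therefore an inclusion at an arbitrary \<open>'w\<close>, and it is proper as soon as it is
  strict at one type.\<close>

definition lfh_frames :: "'w frame set" where
  "lfh_frames = {F. transitive_frame F \<and> locally_finite_height F}"

definition frames_validating :: "'p rule set \<Rightarrow> 'w frame set" where
  "frames_validating S = {F. transitive_frame F \<and> scheme_weakly_valid F S}"

end

theory Submission
  imports Defs
begin

text \<open>
  A world satisfies every \<open>\<Diamond>\<^sup>n\<top>\<close> only if arbitrarily long paths start from it, that is, only if
  its height is infinite
  (\<open>height_infinite_of_all_diamonds\<close>). In a frame of locally finite height no world satisfies all
  \<open>\<Diamond>\<^sup>n\<top>\<close>, so a formula that implies all of them is satisfied nowhere, which is the rule.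

  Properness is witnessed by the ordinal \<open>\<omega> + 1\<close> with every ordinal seeing the smaller ones. The
  top \<open>\<omega>\<close> has infinite height, but a finite ordinal \<open>k\<close> refutes \<open>\<Diamond>\<^sup>k\<^sup>+\<^sup>1\<top>\<close>. Hence the rule can
  fail only for a formula \<open>\<phi>\<close> that is satisfiable at \<open>\<omega>\<close> and, under all valuations, nowhere else.
  There is none: given a valuation, give a finite ordinal \<open>N\<close> the atoms of \<open>\<omega>\<close>. Ordinals below
  \<open>N\<close> do not notice the change, and once \<open>N\<close> lies above a counterexample to each \<open>\<psi>\<close> with
  \<open>\<box>\<psi>\<close> a subformula of \<open>\<phi>\<close> refuted at \<open>\<omega>\<close>, the ordinals \<open>N\<close> and \<open>\<omega>\<close> agree on \<open>\<phi>\<close>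
  (\<open>eventually_copy_agrees_with_top\<close>). The premises of the rule are about all valuations, so they
  apply to the new one and are contradicted at \<open>N\<close>.
\<close>

section \<open>Iterated diamonds and height\<close>

lemma extend_subset_worlds:
  assumes "valuation F v"
  shows "extend F v \<phi> \<subseteq> worlds F"
  using assms by (induction \<phi>) (auto simp: valuation_def)

lemma extend_Imp:
  assumes "valuation F v"
  shows "extend F v (Imp \<phi> \<psi>) = worlds F - (extend F v \<phi> - extend F v \<psi>)"
  using extend_subset_worlds[OF assms] by (auto simp: Imp_def)

lemma valid_Imp_iff:
  "valid F (Imp \<phi> \<psi>) \<longleftrightarrow> (\<forall>v. valuation F v \<longrightarrow> extend F v \<phi> \<subseteq> extend F v \<psi>)"
  unfolding valid_def using extend_Imp extend_subset_worlds by fastforce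

lemma mem_extend_Dia:
  "w \<in> extend F v (Dia \<phi>) \<longleftrightarrow>
     w \<in> worlds F \<and> (\<exists>u \<in> worlds F. (w, u) \<in> acc F \<and> u \<in> extend F v \<phi>)"
  by (auto simp: Dia_def)

lemma diamond_star_weakly_valid_iff:
  "scheme_weakly_valid F (diamond_star :: 'p rule set) \<longleftrightarrow>
     (\<forall>\<phi> :: 'p fm.
        (\<forall>n v. valuation F v \<longrightarrow> extend F v \<phi> \<subseteq> extend F v ((Dia ^^ n) Top)) \<longrightarrow>
        (\<forall>v. valuation F v \<longrightarrow> extend F v \<phi> = {}))"
proof -
  have "scheme_weakly_valid F (diamond_star :: 'p rule set) \<longleftrightarrow>
      (\<forall>\<phi> :: 'p fm. (\<forall>n. valid F (Imp \<phi> ((Dia ^^ n) Top))) \<longrightarrow> valid F (Imp \<phi> Bot))"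
    unfolding scheme_weakly_valid_def weakly_valid_def diamond_star_def valid_set_def by auto
  then show ?thesis by (simp add: valid_Imp_iff)
qed

lemma path_of_iterated_diamond:
  assumes "w \<in> extend F v ((Dia ^^ n) Top)"
  shows "\<exists>xs. xs \<noteq> [] \<and> hd xs = w \<and> set xs \<subseteq> worlds F
           \<and> successively (\<lambda>x y. (x, y) \<in> acc F) xs \<and> length xs = Suc n"
  using assms
proof (induction n arbitrary: w)
  case 0
  then show ?case by (intro exI[of _ "[w]"]) simp
next
  case (Suc n)
  then obtain u where w: "w \<in> worlds F" and wu: "(w, u) \<in> acc F"
    and u: "u \<in> extend F v ((Dia ^^ n) Top)"
    by (auto simp: mem_extend_Dia)
  obtain xs where "xs \<noteq> []" "hd xs = u" "set xs \<subseteq> worlds F"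
    "successively (\<lambda>x y. (x, y) \<in> acc F) xs" "length xs = Suc n"
    using Suc.IH[OF u] by blast
  then show ?case
    using w wu by (intro exI[of _ "w # xs"]) (simp add: successively_Cons)
qed

lemma height_infinite_of_all_diamonds:
  assumes "\<And>n. w \<in> extend F v ((Dia ^^ n) Top)"
  shows "height F w = \<infinity>"
proof -
  have le: "enat (Suc n) \<le> height F w" for n
  proof -
    obtain xs where "xs \<noteq> []" "hd xs = w" "set xs \<subseteq> worlds F"
      "successively (\<lambda>x y. (x, y) \<in> acc F) xs" and len: "length xs = Suc n"
      using path_of_iterated_diamond[OF assms[of n]] by blast
    then have "enat (length xs) \<le> height F w"
      unfolding height_def by (intro SUP_upper) simp
    then show ?thesis unfolding len .
  qed
  show ?thesis
  proof (cases "height F w")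
    case (enat m)
    then show ?thesis using le[of m] by simp
  qed
qed

lemma diamond_star_if_locally_finite_height:
  assumes "locally_finite_height F"
  shows "scheme_weakly_valid F (diamond_star :: 'p rule set)"
  unfolding diamond_star_weakly_valid_iff
proof (intro allI impI)
  fix \<phi> :: "'p fm" and v :: "'p \<Rightarrow> _"
  assume prems: "\<forall>n v. valuation F v \<longrightarrow> extend F v \<phi> \<subseteq> extend F v ((Dia ^^ n) Top)"
    and v: "valuation F v"
  have False if "w \<in> extend F v \<phi>" for w
  proof -
    have "height F w = \<infinity>"
      using prems v that by (intro height_infinite_of_all_diamonds[of w F v]) blast
    moreover have "w \<in> worlds F" using extend_subset_worlds[OF v] that by blast
    ultimately show False using assms by (auto simp: locally_finite_height_def)
  qed
  then show "extend F v \<phi> = {}" by blast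
qed

section \<open>The descending chain of type \<open>\<omega> + 1\<close>\<close>

text \<open>The number \<open>0\<close> stands for the ordinal \<open>\<omega>\<close>, and \<open>Suc k\<close> for the finite ordinal \<open>k\<close>.\<close>

definition omega_plus_one :: "nat frame" where
  "omega_plus_one = Frame UNIV {(m, n). n \<noteq> 0 \<and> (m = 0 \<or> n < m)}"

lemma worlds_omega_plus_one [simp]: "worlds omega_plus_one = UNIV"
  and acc_omega_plus_one [simp]:
    "(m, n) \<in> acc omega_plus_one \<longleftrightarrow> n \<noteq> 0 \<and> (m = 0 \<or> n < m)"
  by (simp_all add: omega_plus_one_def)

lemma valuation_omega_plus_one [simp]: "valuation omega_plus_one v"
  by (simp add: valuation_def)

lemma transitive_omega_plus_one: "transitive_frame omega_plus_one"
  unfolding transitive_frame_def kripke_frame_def by (auto intro!: transI)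

lemma mem_iterated_diamond_omega_plus_one:
  "m \<in> extend omega_plus_one v ((Dia ^^ n) Top) \<longleftrightarrow> m = 0 \<or> n < m"
proof (induction n arbitrary: m)
  case (Suc n)
  have "m \<in> extend omega_plus_one v ((Dia ^^ Suc n) Top) \<longleftrightarrow>
      (\<exists>u. u \<noteq> 0 \<and> (m = 0 \<or> u < m) \<and> n < u)"
    by (auto simp: mem_extend_Dia Suc.IH)
  also have "\<dots> \<longleftrightarrow> m = 0 \<or> Suc n < m"
    \<comment> \<open>The least \<open>u\<close> that can serve as a successor is \<open>Suc n\<close>.\<close>
  proof
    assume "m = 0 \<or> Suc n < m"
    then show "\<exists>u. u \<noteq> 0 \<and> (m = 0 \<or> u < m) \<and> n < u" by (intro exI[of _ "Suc n"]) auto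
  qed auto
  finally show ?case .
qed auto

lemma omega_plus_one_not_locally_finite: "\<not> locally_finite_height omega_plus_one"
proof -
  have "height omega_plus_one 0 = \<infinity>"
    by (rule height_infinite_of_all_diamonds[where v = "\<lambda>_. {}"])
      (simp add: mem_iterated_diamond_omega_plus_one)
  then show ?thesis by (auto simp: locally_finite_height_def)
qed

section \<open>Moving a formula from the top to a finite ordinal\<close>

definition copy_top :: "nat \<Rightarrow> ('p \<Rightarrow> nat set) \<Rightarrow> 'p \<Rightarrow> nat set" where
  "copy_top N v p = {m. (if m = Suc N then 0 else m) \<in> v p}"

text \<open>Truth at a world depends only on the atoms there and at the worlds reachable from it, and the
  nonzero worlds below \<open>Suc N\<close> reach
  neither \<open>Suc N\<close> nor \<open>0\<close>.\<close>

lemma copy_top_below: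
  assumes "0 < m" "m < Suc N"
  shows "m \<in> extend omega_plus_one (copy_top N v) \<phi> \<longleftrightarrow> m \<in> extend omega_plus_one v \<phi>"
  using assms by (induction \<phi> arbitrary: m) (auto simp: copy_top_def)

text \<open>Only finitely many boxes occur in \<open>\<phi>\<close>, so a single bound on \<open>N\<close> serves all of them:
  if \<open>Box \<psi>\<close> holds at \<open>0\<close> then it holds at every \<open>Suc N\<close>, which sees less, and otherwise it fails
  at \<open>Suc N\<close> as soon as \<open>Suc N\<close> sees one fixed finite counterexample.\<close>

lemma eventually_copy_agrees_with_top:
  "\<exists>M. \<forall>N \<ge> M. Suc N \<in> extend omega_plus_one (copy_top N v) \<phi> \<longleftrightarrow>
                0 \<in> extend omega_plus_one v \<phi>"
proof (induction \<phi>)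
  case (And \<phi> \<psi>)
  then obtain M1 M2 where
    "\<forall>N \<ge> M1. Suc N \<in> extend omega_plus_one (copy_top N v) \<phi> \<longleftrightarrow> 0 \<in> extend omega_plus_one v \<phi>"
    "\<forall>N \<ge> M2. Suc N \<in> extend omega_plus_one (copy_top N v) \<psi> \<longleftrightarrow> 0 \<in> extend omega_plus_one v \<psi>"
    by blast
  then show ?case by (intro exI[of _ "max M1 M2"]) simp
next
  case (Neg \<phi>)
  then show ?case by simp
next
  case (Box \<psi>)
  have seen: "Suc N \<in> extend omega_plus_one (copy_top N v) (Box \<psi>) \<longleftrightarrow>
      (\<forall>m. 0 < m \<and> m < Suc N \<longrightarrow> m \<in> extend omega_plus_one v \<psi>)" for N
    using copy_top_below[of _ N v \<psi>] by auto
  show ?case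
  proof (cases "0 \<in> extend omega_plus_one v (Box \<psi>)")
    case True
    then show ?thesis unfolding seen by simp
  next
    case False
    then obtain m where "0 < m" "m \<notin> extend omega_plus_one v \<psi>" by auto
    then have "Suc N \<notin> extend omega_plus_one (copy_top N v) (Box \<psi>)" if "m \<le> N" for N
      unfolding seen using that by (auto simp: less_Suc_eq_le)
    then show ?thesis using False by blast
  qed
qed (auto simp: copy_top_def)

lemma diamond_star_omega_plus_one:
  "scheme_weakly_valid omega_plus_one (diamond_star :: 'p rule set)"
  unfolding diamond_star_weakly_valid_iff
proof (intro allI impI)
  fix \<phi> :: "'p fm" and v :: "'p \<Rightarrow> _"
  assume prems: "\<forall>n v. valuation omega_plus_one v \<longrightarrow>
      extend omega_plus_one v \<phi> \<subseteq> extend omega_plus_one v ((Dia ^^ n) Top)"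
  have finite_refutes: "Suc k \<notin> extend omega_plus_one u \<phi>" for k u
  proof
    assume "Suc k \<in> extend omega_plus_one u \<phi>"
    then have "Suc k \<in> extend omega_plus_one u ((Dia ^^ Suc k) Top)"
      using prems valuation_omega_plus_one by blast
    then show False unfolding mem_iterated_diamond_omega_plus_one by simp
  qed
  have "0 \<notin> extend omega_plus_one v \<phi>"
    using eventually_copy_agrees_with_top[of v \<phi>] finite_refutes by blast
  then have "m \<notin> extend omega_plus_one v \<phi>" for m
    using finite_refutes by (cases m) auto
  then show "extend omega_plus_one v \<phi> = {}" by blast
qed

section \<open>Proper inclusion of the classes\<close>

lemma lfh_frames_subset: "lfh_frames \<subseteq> frames_validating (diamond_star :: 'p rule set)"
  by (auto simp: lfh_frames_def frames_validating_def diamond_star_if_locally_finite_height)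

theorem theorem5p1:
  shows "(lfh_frames :: 'w frame set) \<subseteq> frames_validating (diamond_star :: 'p::countable rule set)
    \<and> (lfh_frames :: nat frame set) \<subset> frames_validating (diamond_star :: 'p::countable rule set)"
proof -
  have "omega_plus_one \<in> frames_validating (diamond_star :: 'p rule set)"
    by (simp add: frames_validating_def transitive_omega_plus_one diamond_star_omega_plus_one)
  moreover have "omega_plus_one \<notin> lfh_frames"
    by (simp add: lfh_frames_def omega_plus_one_not_locally_finite)
  ultimately have "(lfh_frames :: nat frame set) \<noteq> frames_validating (diamond_star :: 'p rule set)"
    by metis
  then show ?thesis by (simp add: psubset_eq lfh_frames_subset)
qed

end
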